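(* Let $\omega, p, q$ be real numbers with $\omega>0$ and $q>p>1$, and let $f(u)=-\omega u+u^p-u^q$ for $u\ge 0$. If $$F(u):=\int_0^u f(s)\,ds>0\quad\text{for some } u>0,$$ then $$\tilde f(u):=(uf'(u))'f(u)-u\,f'(u)^2<0\quad\text{for every } u>0.$$
   Context: Primes denote differentiation with respect to $u$; thus $(uf'(u))'$ is the derivative of the function $u\mapsto u f'(u)$, and $u\,f'(u)^2$ means $u\cdot (f'(u))^2$. Powers $u^p$, $u^q$ are real powers of nonnegative reals. *)

theory Defs
  imports "HOL-Analysis.Analysis"
begin

(* Only the values at u >= 0 matter; powr is the real power there, with 0 powr a = 0. *)
definition dpower :: "real \<Rightarrow> real \<Rightarrow> real \<Rightarrow> real \<Rightarrow> real" where
  "dpower \<omega> p q u = - \<omega> * u + u powr p - u powr q"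

definition prim :: "(real \<Rightarrow> real) \<Rightarrow> real \<Rightarrow> real" where
  "prim f u = integral {0..u} f"

definition tilde :: "(real \<Rightarrow> real) \<Rightarrow> real \<Rightarrow> real" where
  "tilde f u = deriv (\<lambda>v. v * deriv f v) u * f u - u * (deriv f u)\<^sup>2"

end

theory Submission
  imports Defs
begin

text \<open>
  Put \<open>P = p - 1\<close>, \<open>Q = q - 1\<close>. The operator \<open>f \<mapsto> (u f')' f - u f'^2\<close> is quadratic, and for a sum of
  monomials \<open>c\<^sub>i u^e\<^sub>i\<close> the diagonal terms cancel: what remains is
  \<open>\<Sum>i<j. c\<^sub>i c\<^sub>j (e\<^sub>i - e\<^sub>j)^2 u^(e\<^sub>i + e\<^sub>j - 1)\<close>. For the exponents \<open>1, p, q\<close> the claim therefore reads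
  \<open>\<omega> (Q\<^sup>2 u^Q - P\<^sup>2 u^P) < (Q - P)\<^sup>2 u^(P + Q)\<close> for all \<open>u > 0\<close>.

  The hypothesis enters only through a weak consequence: if the primitive of \<open>f\<close> is positive somewhere,
  then so is \<open>f\<close>, that is, \<open>\<omega> < s^P - s^Q\<close> for some \<open>s > 0\<close>. This already suffices, because
  \<open>s^P - s^Q\<close> as a function of \<open>s\<close> and \<open>(Q\<^sup>2 u^Q - P\<^sup>2 u^P) / u^(P + Q)\<close> as a function of \<open>u\<close> are
  both maximal at the same point \<open>r\<close>, given by \<open>r^(Q - P) = P / Q\<close>, and the product of the two maxima is
  exactly \<open>(Q - P)\<^sup>2\<close> (lemma \<open>powr_gap_product_le\<close>). After rescaling by \<open>r\<close> both maxima are the same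
  one-variable inequality \<open>Q x^P - P x^Q \<le> Q - P\<close> (lemma \<open>powr_gap_le\<close>).
\<close>

text \<open>
  Equality holds at \<open>x = 1\<close>. Divided by \<open>x^P\<close>, the inequality is the combination with weights
  \<open>P\<close> and \<open>Q - P\<close> of the tangent bounds \<open>x^c \<ge> 1 + c ln x\<close> for \<open>c = Q - P\<close> and \<open>c = -P\<close>, in which the
  logarithms cancel.
\<close>

lemma powr_gap_le:
  fixes x P Q :: real
  assumes "x > 0" and "0 < P" and "P < Q"
  shows "Q * x powr P - P * x powr Q \<le> Q - P"
proof -
  have tangent: "1 + c * ln x \<le> x powr c" for c
    using exp_ge_add_one_self[of "c * ln x"] \<open>x > 0\<close> by (simp add: powr_def)
  have "P * (1 + (Q - P) * ln x) + (Q - P) * (1 + (- P) * ln x)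
      \<le> P * x powr (Q - P) + (Q - P) * x powr (- P)"
    using assms by (intro add_mono mult_left_mono tangent) auto
  then have "Q \<le> P * x powr (Q - P) + (Q - P) * x powr (- P)"
    by (simp add: algebra_simps)
  then have "x powr P * Q \<le> x powr P * (P * x powr (Q - P) + (Q - P) * x powr (- P))"
    by (intro mult_left_mono) auto
  also have "\<dots> = P * (x powr P * x powr (Q - P)) + (Q - P) * (x powr P * x powr (- P))"
    by (simp add: algebra_simps)
  also have "\<dots> = P * x powr Q + (Q - P)"
    using \<open>x > 0\<close> by (simp flip: powr_add)
  finally show ?thesis by (simp add: algebra_simps)
qed

text \<open>
  Both factors on the left are bounded by their maxima at \<open>r\<close>, up to the factor \<open>u^P u^Q\<close> in the second:
  \<open>s^P - s^Q \<le> r^P (Q - P) / Q\<close> from \<open>x = s / r\<close>, and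
  \<open>Q\<^sup>2 u^Q - P\<^sup>2 u^P \<le> u^P u^Q Q (Q - P) / r^P\<close> from \<open>x = r / u\<close>.
\<close>

lemma powr_gap_product_le:
  fixes s u P Q :: real
  assumes "s > 0" and "u > 0" and "0 < P" and "P < Q"
    and pos: "0 \<le> Q\<^sup>2 * u powr Q - P\<^sup>2 * u powr P"
  shows "(s powr P - s powr Q) * (Q\<^sup>2 * u powr Q - P\<^sup>2 * u powr P)
    \<le> (Q - P)\<^sup>2 * (u powr P * u powr Q)"
proof -
  define r where "r = (P / Q) powr (1 / (Q - P))"
  have "r > 0" using assms by (simp add: r_def)
  have "r powr (Q - P) = P / Q"
    using assms by (simp add: r_def powr_powr)
  moreover have "r powr Q = r powr P * r powr (Q - P)"
    by (simp flip: powr_add)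
  ultimately have crit: "Q * r powr Q = P * r powr P"
    using assms by simp
  have s_bound: "Q * (s powr P - s powr Q) \<le> (Q - P) * r powr P"
  proof -
    have "Q * (s / r) powr P - P * (s / r) powr Q \<le> Q - P"
      using assms \<open>r > 0\<close> by (intro powr_gap_le) auto
    then have "r powr P * (Q * (s / r) powr P - P * (s / r) powr Q) \<le> r powr P * (Q - P)"
      by (intro mult_left_mono) auto
    also have "r powr P * (Q * (s / r) powr P - P * (s / r) powr Q)
        = Q * s powr P - (P * r powr P) * s powr Q / r powr Q"
      using assms \<open>r > 0\<close> by (simp add: powr_divide field_simps)
    also have "\<dots> = Q * (s powr P - s powr Q)"
      using \<open>r > 0\<close> by (simp add: crit[symmetric] algebra_simps)
    finally show ?thesis by (simp add: mult.commute)
  qed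
  have u_bound: "r powr P * (Q\<^sup>2 * u powr Q - P\<^sup>2 * u powr P) \<le> Q * (Q - P) * (u powr P * u powr Q)"
  proof -
    have "Q * (r / u) powr P - P * (r / u) powr Q \<le> Q - P"
      using assms \<open>r > 0\<close> by (intro powr_gap_le) auto
    then have "Q * (u powr P * u powr Q) * (Q * (r / u) powr P - P * (r / u) powr Q)
        \<le> Q * (u powr P * u powr Q) * (Q - P)"
      using assms by (intro mult_left_mono) auto
    also have "Q * (u powr P * u powr Q) * (Q * (r / u) powr P - P * (r / u) powr Q)
        = Q\<^sup>2 * u powr Q * r powr P - P * u powr P * (Q * r powr Q)"
      using assms \<open>r > 0\<close> by (simp add: powr_divide field_simps power2_eq_square)
    also have "\<dots> = r powr P * (Q\<^sup>2 * u powr Q - P\<^sup>2 * u powr P)"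
      by (simp add: crit algebra_simps power2_eq_square)
    finally show ?thesis by (simp add: algebra_simps)
  qed
  have "Q * (s powr P - s powr Q) * (Q\<^sup>2 * u powr Q - P\<^sup>2 * u powr P)
      \<le> (Q - P) * r powr P * (Q\<^sup>2 * u powr Q - P\<^sup>2 * u powr P)"
    using s_bound pos by (rule mult_right_mono)
  also have "\<dots> = (Q - P) * (r powr P * (Q\<^sup>2 * u powr Q - P\<^sup>2 * u powr P))"
    by (rule mult.assoc)
  also have "\<dots> \<le> (Q - P) * (Q * (Q - P) * (u powr P * u powr Q))"
    using u_bound \<open>P < Q\<close> by (intro mult_left_mono) auto
  also have "\<dots> = Q * ((Q - P)\<^sup>2 * (u powr P * u powr Q))"
    by (simp only: power2_eq_square mult_ac)
  finally have "Q * ((s powr P - s powr Q) * (Q\<^sup>2 * u powr Q - P\<^sup>2 * u powr P))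
      \<le> Q * ((Q - P)\<^sup>2 * (u powr P * u powr Q))"
    by (simp only: mult.assoc)
  then show ?thesis using assms by simp
qed

lemma deriv_dpower:
  assumes "u > 0"
  shows "deriv (dpower \<omega> p q) u = - \<omega> + p * u powr (p - 1) - q * u powr (q - 1)"
proof -
  have "((\<lambda>u. - \<omega> * u + u powr p - u powr q) has_real_derivative
      (- \<omega> + p * u powr (p - 1) - q * u powr (q - 1))) (at u)"
    using assms by (auto intro!: derivative_eq_intros)
  then show ?thesis
    by (simp add: DERIV_imp_deriv dpower_def[abs_def])
qed

lemma deriv_mult_deriv_dpower:
  assumes "u > 0"
  shows "deriv (\<lambda>v. v * deriv (dpower \<omega> p q) v) u
    = - \<omega> + p\<^sup>2 * u powr (p - 1) - q\<^sup>2 * u powr (q - 1)"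
proof -
  have "((\<lambda>v. - \<omega> * v + p * v powr p - q * v powr q) has_real_derivative
      (- \<omega> + p\<^sup>2 * u powr (p - 1) - q\<^sup>2 * u powr (q - 1))) (at u)"
    using assms by (auto intro!: derivative_eq_intros simp: power2_eq_square)
  then have "((\<lambda>v. v * deriv (dpower \<omega> p q) v) has_real_derivative
      (- \<omega> + p\<^sup>2 * u powr (p - 1) - q\<^sup>2 * u powr (q - 1))) (at u)"
  proof (rule has_field_derivative_transform_within_open)
    show "- \<omega> * v + p * v powr p - q * v powr q = v * deriv (dpower \<omega> p q) v"
      if "v \<in> {0<..}" for v
      using that by (simp add: deriv_dpower powr_diff algebra_simps)
  qed (use assms in auto)
  then show ?thesis by (rule DERIV_imp_deriv)
qed

lemma tilde_dpower:
  assumes "u > 0"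
  shows "tilde (dpower \<omega> p q) u
    = u * (\<omega> * ((q - 1)\<^sup>2 * u powr (q - 1) - (p - 1)\<^sup>2 * u powr (p - 1))
        - (q - p)\<^sup>2 * (u powr (p - 1) * u powr (q - 1)))"
proof -
  define a b where "a = u powr (p - 1)" and "b = u powr (q - 1)"
  have "dpower \<omega> p q u = u * (- \<omega> + a - b)"
    using assms by (simp add: dpower_def a_def b_def powr_diff algebra_simps)
  then have "tilde (dpower \<omega> p q) u
      = (- \<omega> + p\<^sup>2 * a - q\<^sup>2 * b) * (u * (- \<omega> + a - b)) - u * (- \<omega> + p * a - q * b)\<^sup>2"
    using assms by (simp add: tilde_def deriv_dpower deriv_mult_deriv_dpower a_def b_def)
  also have "\<dots> = u * (\<omega> * ((q - 1)\<^sup>2 * b - (p - 1)\<^sup>2 * a) - (q - p)\<^sup>2 * (a * b))"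
    by (simp add: power2_eq_square algebra_simps)
  finally show ?thesis by (simp add: a_def b_def)
qed

lemma pos_value_of_pos_prim:
  assumes "prim f u > 0"
  shows "\<exists>s\<ge>0. f s > 0"
proof (rule ccontr)
  assume "\<not> ?thesis"
  then have neg: "f s \<le> 0" if "0 \<le> s" for s
    using that by (auto simp: not_less)
  \<comment> \<open>\<open>prim\<close> has the value 0 when \<open>f\<close> is not integrable, so positivity forces integrability.\<close>
  have "f integrable_on {0..u}"
    by (rule ccontr) (use assms in \<open>simp add: prim_def not_integrable_integral\<close>)
  then have "integral {0..u} f \<le> integral {0..u} (\<lambda>_. 0)"
    by (intro integral_le) (auto intro: neg)
  then show False using assms by (simp add: prim_def)
qed

theorem theorem1:
  fixes \<omega> p q :: real
  assumes "\<omega> > 0" and "p > 1" and "q > p"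
    and "\<exists>u>0. prim (dpower \<omega> p q) u > 0"
  shows "\<forall>u>0. tilde (dpower \<omega> p q) u < 0"
proof (intro allI impI)
  fix u :: real
  assume "u > 0"
  define P Q where "P = p - 1" and "Q = q - 1"
  have PQ: "0 < P" "P < Q" using assms by (auto simp: P_def Q_def)
  obtain s where "0 \<le> s" and fs: "dpower \<omega> p q s > 0"
    using assms(4) pos_value_of_pos_prim by blast
  then have "s > 0" by (cases "s = 0") (auto simp: dpower_def)
  have "dpower \<omega> p q s = s * (s powr P - s powr Q - \<omega>)"
    using \<open>s > 0\<close> by (simp add: dpower_def P_def Q_def powr_diff algebra_simps)
  then have \<omega>_less: "\<omega> < s powr P - s powr Q"
    using fs \<open>s > 0\<close> by (simp add: zero_less_mult_iff)
  define D where "D = Q\<^sup>2 * u powr Q - P\<^sup>2 * u powr P"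
  have "\<omega> * D < (Q - P)\<^sup>2 * (u powr P * u powr Q)"
  proof (cases "D > 0")
    case True
    then have "\<omega> * D < (s powr P - s powr Q) * D"
      using \<omega>_less by simp
    also have "\<dots> \<le> (Q - P)\<^sup>2 * (u powr P * u powr Q)"
      unfolding D_def using True \<open>s > 0\<close> \<open>u > 0\<close> PQ
      by (intro powr_gap_product_le) (auto simp: D_def)
    finally show ?thesis .
  next
    case False
    then have "\<omega> * D \<le> 0" using assms(1) by (simp add: mult_le_0_iff)
    also have "0 < (Q - P)\<^sup>2 * (u powr P * u powr Q)" using PQ \<open>u > 0\<close> by simp
    finally show ?thesis .
  qed
  then show "tilde (dpower \<omega> p q) u < 0"
    using \<open>u > 0\<close>
    by (simp add: tilde_dpower D_def P_def Q_def mult_less_0_iff)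
qed

end
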